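(* For every positive integer $n$, $\beta_1(n)=\lceil\frac n2\rceil$.
   Context: For a positive integer $n$, $[n]=\{1,\dots,n\}$. For a set $D$ of integers and families $\mathcal{F},\mathcal{F}'$ of subsets of $[n]$, $\mathcal{F}'$ is called $D$-secting for $\mathcal{F}$ if for every $A\in\mathcal{F}$ there exists $A'\in\mathcal{F}'$ with $|A\cap A'|-|A\cap([n]\setminus A')|\in D$. $\beta_D(\mathcal{F})$ is the minimum cardinality of a $D$-secting family for $\mathcal{F}$, and $\beta_1(\mathcal{F})=\beta_D(\mathcal{F})$ for $D=\{1\}$. Since $|A\cap A'|-|A\cap([n]\setminus A')|$ has the parity of $|A|$, only subsets of odd cardinality are considered: $\beta_1(n)$ is the maximum of $\beta_1(\mathcal{F})$ over all families $\mathcal{F}$ of odd-cardinality subsets of $[n]$ (equivalently, $\beta_1$ of the family of all odd-cardinality subsets of $[n]$). *)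

theory Defs
  imports Complex_Main
begin

definition secting :: "nat \<Rightarrow> int set \<Rightarrow> nat set set \<Rightarrow> nat set set \<Rightarrow> bool" where
  "secting n D F F' \<longleftrightarrow>
     F \<subseteq> Pow {1..n} \<and> F' \<subseteq> Pow {1..n} \<and>
     (\<forall>A\<in>F. \<exists>A'\<in>F'. int (card (A \<inter> A')) - int (card (A \<inter> ({1..n} - A'))) \<in> D)"

(* Meaningful only if a D-secting family exists; for D = {1} and families of odd-cardinality
   sets this is lemma secting_odd_exists. *)
definition beta_D :: "nat \<Rightarrow> int set \<Rightarrow> nat set set \<Rightarrow> nat" where
  "beta_D n D F = Min (card ` {F'. secting n D F F'})"

definition odd_sets :: "nat \<Rightarrow> nat set set" where
  "odd_sets n = {A. A \<subseteq> {1..n} \<and> odd (card A)}"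

definition beta_1 :: "nat \<Rightarrow> nat" where
  "beta_1 n = Max (beta_D n {1} ` {F. F \<subseteq> odd_sets n})"

lemma finite_secting: "finite {F'. secting n D F F'}"
proof -
  have "{F'. secting n D F F'} \<subseteq> Pow (Pow {1..n})"
    by (auto simp: secting_def)
  then show ?thesis
    by (rule finite_subset) simp
qed

lemma secting_odd_exists:
  assumes "F \<subseteq> odd_sets n"
  shows "secting n {1} F (Pow {1..n})"
  unfolding secting_def
proof (intro conjI ballI)
  show "F \<subseteq> Pow {1..n}"
    using assms by (auto simp: odd_sets_def)
  show "Pow {1..n} \<subseteq> Pow {1..n}" ..
  fix A assume "A \<in> F"
  with assms have A: "A \<subseteq> {1..n}" "odd (card A)"
    by (auto simp: odd_sets_def)
  then have fin: "finite A"
    by (auto intro: finite_subset)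
  obtain k where k: "card A = 2 * k + 1"
    using A(2) by (elim oddE)
  then obtain B where B: "B \<subseteq> A" "card B = k + 1"
    using obtain_subset_with_card_n[of "k + 1" A] by auto
  have "A \<inter> B = B" "A \<inter> ({1..n} - B) = A - B"
    using A(1) B(1) by auto
  moreover have "card (A - B) = k"
    using B fin k by (simp add: card_Diff_subset finite_subset)
  ultimately have "int (card (A \<inter> B)) - int (card (A \<inter> ({1..n} - B))) \<in> {1}"
    using B(2) by simp
  then show "\<exists>A'\<in>Pow {1..n}. int (card (A \<inter> A')) - int (card (A \<inter> ({1..n} - A'))) \<in> {1}"
    by (rule bexI) (use A(1) B(1) in auto)
qed

lemma beta_D_mono:
  assumes "F \<subseteq> G" "G \<subseteq> odd_sets n"
  shows "beta_D n {1} F \<le> beta_D n {1} G"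
  unfolding beta_D_def
proof (rule Min_antimono)
  show "card ` {F'. secting n {1} G F'} \<subseteq> card ` {F'. secting n {1} F F'}"
  proof (intro image_mono Collect_mono impI)
    fix F' assume "secting n {1} G F'"
    with assms(1) show "secting n {1} F F'"
      unfolding secting_def by (meson subsetD subset_trans)
  qed
  show "card ` {F'. secting n {1} G F'} \<noteq> {}"
    using secting_odd_exists[OF assms(2)] by blast
  show "finite (card ` {F'. secting n {1} F F'})"
    by (simp add: finite_secting)
qed

lemma beta_1_eq_all_odd: "beta_1 n = beta_D n {1} (odd_sets n)"
  unfolding beta_1_def
proof (rule Max_eqI)
  have "{F. F \<subseteq> odd_sets n} \<subseteq> Pow (Pow {1..n})"
    by (auto simp: odd_sets_def)
  then have "finite {F. F \<subseteq> odd_sets n}"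
    by (rule finite_subset) simp
  then show "finite (beta_D n {1} ` {F. F \<subseteq> odd_sets n})"
    by simp
qed (auto intro: beta_D_mono)

end

theory Submission
  imports Defs
begin

text \<open>
  Lower bound: let \<open>P(A)\<close> be the product over the members \<open>A'\<close> of a secting family of
  \<open>|A \<inter> A'| - |A - A'| - 1\<close>. It vanishes for odd \<open>|A|\<close>, and for even \<open>|A|\<close> it is odd, hence nonzero.
  So the alternating sum of \<open>P(A)\<^sup>2\<close> over all \<open>A \<subseteq> [n]\<close> is positive. But \<open>P\<^sup>2\<close> is a product of
  twice as many affine functions as there are members, and such an alternating sum is zero for
  fewer than \<open>n\<close> factors.

  Upper bound: write \<open>n = 2k + 1\<close> or \<open>n = 2k + 2\<close> and take the \<open>k + 1\<close> sets
  \<open>{i+1..i+k} \<union> {2k+1..n}\<close> for \<open>i \<le> k\<close>. The window \<open>{i+1..i+k}\<close> moves from one half of \<open>[2k]\<close> to the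
  other, so its imbalance on \<open>A\<close> goes from some \<open>d\<close> to \<open>-d\<close> in steps of at most 2, and takes every
  value in \<open>{-1,0,1}\<close> of the right parity; the at most two elements beyond \<open>2k\<close> only shift the
  value that is needed within \<open>{-1,0,1}\<close>.
\<close>

text \<open>Induction on \<open>S\<close>: pairing \<open>A\<close> with \<open>insert s A\<close>
  cancels the full product over \<open>J\<close>. What is left are products over proper subsets
  \<open>T\<close> of \<open>J\<close>, few enough factors for the induction hypothesis.\<close>

lemma alternating_sum_prod_affine_eq_0:
  fixes w :: "'b \<Rightarrow> 'a \<Rightarrow> 'c::comm_ring_1"
  assumes "finite S" "finite J" "card J < card S"
  shows "(\<Sum>A\<in>Pow S. (-1) ^ card A * (\<Prod>j\<in>J. (\<Sum>a\<in>A. w j a) + c j)) = 0"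
  using assms
proof (induction S arbitrary: J rule: finite_induct)
  case empty
  then show ?case by simp
next
  case (insert s S)
  define f where "f j A = (\<Sum>a\<in>A. w j a) + c j" for j A
  have f_insert: "f j (insert s A) = f j A + w j s" if "A \<in> Pow S" for j A
  proof -
    have "finite A" "s \<notin> A"
      using that insert.hyps by (auto intro: finite_subset)
    then show ?thesis by (simp add: f_def algebra_simps)
  qed
  have card_ins: "card (insert s A) = Suc (card A)" if "A \<in> Pow S" for A
    using that insert.hyps by (intro card_insert_disjoint) (auto intro: finite_subset)
  have inj: "inj_on (insert s) (Pow S)"
    using insert.hyps by (auto intro!: inj_onI)
  have expand: "(\<Prod>j\<in>J. f j A + w j s)
      = (\<Prod>j\<in>J. f j A) + (\<Sum>T\<in>Pow J - {J}. (\<Prod>j\<in>T. f j A) * (\<Prod>j\<in>J - T. w j s))" for A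
    using insert.prems(1) by (simp add: prod_add sum.remove[of "Pow J" J])
  have "(\<Sum>A\<in>Pow (insert s S). (-1) ^ card A * (\<Prod>j\<in>J. f j A))
      = (\<Sum>A\<in>Pow S. (-1) ^ card A * (\<Prod>j\<in>J. f j A))
        + (\<Sum>A\<in>insert s ` Pow S. (-1) ^ card A * (\<Prod>j\<in>J. f j A))"
    unfolding Pow_insert using insert.hyps by (intro sum.union_disjoint) auto
  also have "(\<Sum>A\<in>insert s ` Pow S. (-1) ^ card A * (\<Prod>j\<in>J. f j A))
      = (\<Sum>A\<in>Pow S. - ((-1) ^ card A * (\<Prod>j\<in>J. f j A + w j s)))"
    unfolding sum.reindex[OF inj] by (intro sum.cong) (simp_all add: f_insert card_ins del: Pow_iff)
  also have "(\<Sum>A\<in>Pow S. (-1) ^ card A * (\<Prod>j\<in>J. f j A)) + \<dots>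
      = - (\<Sum>A\<in>Pow S. \<Sum>T\<in>Pow J - {J}.
            (-1) ^ card A * ((\<Prod>j\<in>T. f j A) * (\<Prod>j\<in>J - T. w j s)))"
    by (simp add: expand sum.distrib[symmetric] sum_negf[symmetric] sum_distrib_left algebra_simps)
  also have "(\<Sum>A\<in>Pow S. \<Sum>T\<in>Pow J - {J}.
            (-1) ^ card A * ((\<Prod>j\<in>T. f j A) * (\<Prod>j\<in>J - T. w j s)))
      = (\<Sum>T\<in>Pow J - {J}. (\<Sum>A\<in>Pow S. (-1) ^ card A * (\<Prod>j\<in>T. f j A)) * (\<Prod>j\<in>J - T. w j s))"
    by (subst sum.swap) (simp add: sum_distrib_right mult.assoc)
  also have "\<dots> = 0"
  proof (intro sum.neutral ballI)
    fix T assume T: "T \<in> Pow J - {J}"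
    then have "card T < card J"
      using insert.prems(1) by (intro psubset_card_mono) auto
    then have "(\<Sum>A\<in>Pow S. (-1) ^ card A * (\<Prod>j\<in>T. f j A)) = 0"
      unfolding f_def using T insert by (intro insert.IH) (auto intro: finite_subset)
    then show "(\<Sum>A\<in>Pow S. (-1) ^ card A * (\<Prod>j\<in>T. f j A)) * (\<Prod>j\<in>J - T. w j s) = 0"
      by simp
  qed
  finally show ?case by (simp add: f_def)
qed

lemma imbalance_eq:
  fixes A B :: "nat set"
  assumes "A \<subseteq> {1..n}"
  shows "int (card (A \<inter> B)) - int (card (A \<inter> ({1..n} - B))) = 2 * int (card (A \<inter> B)) - int (card A)"
proof -
  have "finite A"
    using assms by (rule finite_subset) simp
  moreover have "A \<inter> ({1..n} - B) = A - B"
    using assms by auto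
  ultimately show ?thesis
    using card_Int_Diff[of A B] by simp
qed

lemma card_secting_odd_sets_ge:
  assumes "secting n {1} (odd_sets n) F"
  shows "n \<le> 2 * card F"
proof (rule ccontr)
  assume less: "\<not> n \<le> 2 * card F"
  have "F \<subseteq> Pow {1..n}"
    using assms by (simp add: secting_def)
  then have fin: "finite F"
    by (rule finite_subset) simp
  define w :: "nat set \<Rightarrow> nat \<Rightarrow> int" where "w B a = (if a \<in> B then 1 else -1)" for B a
  define P where "P A = (\<Prod>B\<in>F. (\<Sum>a\<in>A. w B a) + (-1))" for A
  have sum_w: "(\<Sum>a\<in>A. w B a) = 2 * int (card (A \<inter> B)) - int (card A)" if "finite A" for A B
  proof -
    have "(\<Sum>a\<in>A. w B a) = int (card (A \<inter> B)) - int (card (A - B))"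
      unfolding w_def using that by (simp add: sum.If_cases Diff_eq)
    then show ?thesis
      using card_Int_Diff[OF that, of B] by simp
  qed
  have P_odd: "P A = 0" if A: "A \<subseteq> {1..n}" "odd (card A)" for A
  proof -
    have "finite A" using A(1) by (rule finite_subset) simp
    have "A \<in> odd_sets n" using A by (simp add: odd_sets_def)
    then obtain B where "B \<in> F"
      "int (card (A \<inter> B)) - int (card (A \<inter> ({1..n} - B))) = 1"
      using assms unfolding secting_def by blast
    then have "B \<in> F" "2 * int (card (A \<inter> B)) - int (card A) = 1"
      by (simp_all only: imbalance_eq[OF A(1)])
    then show ?thesis
      unfolding P_def using fin \<open>finite A\<close>
      by (intro prod_zero bexI[of _ B]) (simp_all add: sum_w)
  qed
  have P_even: "P A \<noteq> 0" if "A \<subseteq> {1..n}" "even (card A)" for A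
  proof -
    have "finite A" using that(1) by (rule finite_subset) simp
    then have "odd ((\<Sum>a\<in>A. w B a) + (-1))" for B
      using that(2) by (simp add: sum_w)
    then have "(\<Sum>a\<in>A. w B a) + (-1) \<noteq> 0" for B
      by (metis even_zero)
    then show ?thesis
      unfolding P_def using fin by simp
  qed
  \<comment> \<open>The factor \<open>bool\<close> lists each affine factor twice, so the index set
    has \<open>2 * card F\<close> elements.\<close>
  have square: "(P A)\<^sup>2 = (\<Prod>j\<in>F \<times> (UNIV::bool set). (\<Sum>a\<in>A. w (fst j) a) + (-1))" for A
    by (simp add: P_def prod.cartesian_product' UNIV_bool power2_eq_square prod.distrib)
  have "(\<Sum>A\<in>Pow {1..n}. (-1) ^ card A * (P A)\<^sup>2) = 0"
    unfolding square using fin less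
    by (intro alternating_sum_prod_affine_eq_0) (auto simp: card_cartesian_product)
  \<comment> \<open>Odd \<open>A\<close> contribute 0, even \<open>A\<close> have sign +1, and the
    empty set gives a strictly positive term.\<close>
  moreover have "(\<Sum>A\<in>Pow {1..n}. (-1) ^ card A * (P A)\<^sup>2) > 0"
  proof (rule sum_pos2)
    show "0 \<le> (-1) ^ card A * (P A)\<^sup>2" if "A \<in> Pow {1..n}" for A
      using that P_odd[of A] by (cases "even (card A)") auto
    show "0 < (-1) ^ card {} * (P {})\<^sup>2"
      using P_even[of "{}"] by simp
  qed auto
  ultimately show False by simp
qed

text \<open>Which half of \<open>{1..2 * k}\<close> meets \<open>A\<close> in more points is
  unknown, so both directions are needed; the descending one follows by negating
  \<open>g\<close>.\<close>

lemma int_intermediate_value_between: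
  fixes g :: "nat \<Rightarrow> int"
  assumes step: "\<And>i. i < k \<Longrightarrow> \<bar>g (Suc i) - g i\<bar> \<le> 1"
    and between: "min (g 0) (g k) \<le> c" "c \<le> max (g 0) (g k)"
  shows "\<exists>i\<le>k. g i = c"
proof (cases "g 0 \<le> c")
  case True
  show ?thesis
  proof (cases "c \<le> g k")
    case True
    with \<open>g 0 \<le> c\<close> step show ?thesis
      by (intro nat0_intermed_int_val) auto
  next
    case False
    with \<open>g 0 \<le> c\<close> between have "g 0 = c" by auto
    then show ?thesis by blast
  qed
next
  case False
  have "\<exists>i\<le>k. - g i = - c"
  proof (rule nat0_intermed_int_val)
    show "\<forall>i<k. \<bar>- g (i + 1) - - g i\<bar> \<le> 1"
    proof (intro allI impI)
      fix i assume "i < k"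
      with step[of i] show "\<bar>- g (i + 1) - - g i\<bar> \<le> 1" by simp
    qed
  qed (use False between in auto)
  then show ?thesis by simp
qed

text \<open>Each window lies in the other one plus a single point.\<close>

lemma card_Int_window_step:
  fixes A :: "nat set"
  shows "\<bar>int (card (A \<inter> {Suc i + 1..Suc i + k})) - int (card (A \<inter> {i + 1..i + k}))\<bar> \<le> 1"
proof -
  let ?W = "A \<inter> {i + 1..i + k}" and ?W' = "A \<inter> {Suc i + 1..Suc i + k}"
  have "card ?W' \<le> card (insert (Suc i + k) ?W)"
    by (rule card_mono) auto
  moreover have "card ?W \<le> card (insert (i + 1) ?W')"
    by (rule card_mono) auto
  moreover have "card (insert (Suc i + k) ?W) \<le> Suc (card ?W)"
    "card (insert (i + 1) ?W') \<le> Suc (card ?W')"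
    by (rule card_insert_le_m1; simp)+
  ultimately show ?thesis by linarith
qed

lemma secting_odd_sets_windows:
  assumes "2 * k \<le> n" "n \<le> 2 * k + 2"
  shows "secting n {1} (odd_sets n) ((\<lambda>i. {i + 1..i + k} \<union> {2 * k + 1..n}) ` {..k})"
  unfolding secting_def
proof (intro conjI ballI)
  show "odd_sets n \<subseteq> Pow {1..n}"
    by (auto simp: odd_sets_def)
  show "(\<lambda>i. {i + 1..i + k} \<union> {2 * k + 1..n}) ` {..k} \<subseteq> Pow {1..n}"
    using assms by auto
  fix A assume "A \<in> odd_sets n"
  then have A: "A \<subseteq> {1..n}" "odd (card A)"
    by (auto simp: odd_sets_def)
  define g where "g i = int (card (A \<inter> {i + 1..i + k}))" for i
  define t where "t = card (A \<inter> {2 * k + 1..n})"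
  \<comment> \<open>The first and last windows, \<open>i = 0\<close> and \<open>i = k\<close>, are
    the two halves of \<open>{1..2 * k}\<close>.\<close>
  have "A = (A \<inter> {0 + 1..0 + k}) \<union> (A \<inter> {k + 1..k + k}) \<union> (A \<inter> {2 * k + 1..n})"
    using A(1) by auto
  also have "card \<dots> = card (A \<inter> {0 + 1..0 + k}) + card (A \<inter> {k + 1..k + k}) + t"
    unfolding t_def by (subst card_Un_disjoint; auto)+
  finally have card_A: "int (card A) = g 0 + g k + int t"
    by (simp add: g_def)
  have "t \<le> card {2 * k + 1..n}"
    unfolding t_def by (rule card_mono) auto
  then have "t \<le> 2"
    using assms by simp
  obtain q where q: "int (card A) = 2 * q + 1"
    using A(2) by (metis oddE even_of_nat)
  \<comment> \<open>This value makes the imbalance \<open>2 * (g i + t) - card A\<close> equal 1. It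
    differs from the midpoint of \<open>g 0\<close> and \<open>g k\<close> by
    \<open>(1 - t) / 2\<close>, at most 1/2, so as an integer it lies between them.\<close>
  have "\<exists>i\<le>k. g i = q + 1 - int t"
  proof (rule int_intermediate_value_between)
    show "\<bar>g (Suc i) - g i\<bar> \<le> 1" for i
      unfolding g_def by (rule card_Int_window_step)
  qed (use card_A q \<open>t \<le> 2\<close> in linarith)+
  then obtain i where i: "i \<le> k" "g i = q + 1 - int t"
    by blast
  let ?B = "{i + 1..i + k} \<union> {2 * k + 1..n}"
  have "card (A \<inter> ?B) = card (A \<inter> {i + 1..i + k}) + t"
    unfolding t_def Int_Un_distrib using i(1) by (subst card_Un_disjoint) auto
  then have "2 * int (card (A \<inter> ?B)) - int (card A) = 1"
    using i(2) q by (simp add: g_def)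
  then show "\<exists>A'\<in>(\<lambda>i. {i + 1..i + k} \<union> {2 * k + 1..n}) ` {..k}.
      int (card (A \<inter> A')) - int (card (A \<inter> ({1..n} - A'))) \<in> {1}"
    using i(1) unfolding imbalance_eq[OF A(1)] by blast
qed

theorem theorem8:
  fixes n :: nat
  assumes "n \<ge> 1"
  shows "int (beta_1 n) = \<lceil>real n / 2\<rceil>"
proof -
  let ?b = "beta_D n {1} (odd_sets n)"
  define k where "k = (n - 1) div 2"
  let ?F = "(\<lambda>i. {i + 1..i + k} \<union> {2 * k + 1..n}) ` {..k}"
  have fin: "finite (card ` {F. secting n {1} (odd_sets n) F})"
    by (simp add: finite_secting)
  have F: "secting n {1} (odd_sets n) ?F"
    using assms by (intro secting_odd_sets_windows) (auto simp: k_def)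
  then have "?b \<le> card ?F"
    unfolding beta_D_def using fin by (intro Min_le) auto
  also have "\<dots> \<le> k + 1"
    using card_image_le[of "{..k}" "\<lambda>i. {i + 1..i + k} \<union> {2 * k + 1..n}"] by simp
  finally have upper: "?b \<le> k + 1" .
  have "?b \<in> card ` {F. secting n {1} (odd_sets n) F}"
    unfolding beta_D_def using fin F by (intro Min_in) auto
  then have lower: "n \<le> 2 * ?b"
    using card_secting_odd_sets_ge by auto
  \<comment> \<open>With \<open>?b \<le> k + 1\<close> this gives the strict bound
    \<open>?b - 1 < n / 2\<close> that the ceiling requires.\<close>
  have "2 * k + 1 \<le> n"
    using assms by (auto simp: k_def)
  with upper lower show ?thesis
    unfolding beta_1_eq_all_odd by (intro ceiling_unique[symmetric]) auto
qed

end
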